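(* Let $(X,\cdot,\ast)$ be a P{\l}onka bi-magma. Then: (1) The associated canonical map $R=R_{(\cdot,\ast)}: X\times X\to X\times X$, defined for any $x,y\in X$ by $R(x,y)=(x\cdot y,\ x\ast y)$, is a YB-solution. (2) $R$ is unitary if and only if the P{\l}onka bi-magma $(X,\cdot,\ast)$ is unitary. (3) $R$ is involutive if and only if $(X,\cdot)$ is a right involutory magma and $(X,\ast)$ is a left involutory magma. (4) $R$ is (left-right) non-degenerate if and only if $X=\{\star\}$ is a singleton set.
   Context: A magma is a set with a binary operation; a bi-magma $(X,\cdot,\ast)$ is a set with two binary operations. A P{\l}onka bi-magma is a bi-magma $(X,\cdot,\ast)$ such that for all $x,y,z\in X$: - ($(X,\cdot)$ is a right P{\l}onka magma) $(x\cdot y)\cdot z=(x\cdot z)\cdot y$ and $x\cdot(y\cdot z)=x\cdot y$; - ($(X,\ast)$ is a left P{\l}onka magma) $x\ast(y\ast z)=y\ast(x\ast z)$ and $(x\ast y)\ast z=y\ast z$; - $x\ast(y\cdot z)=(x\ast y)\cdot z$, $\ (x\cdot z)\ast y=x\ast y$, $\ x\cdot(y\ast z)=x\cdot z$. It is called unitary if $(x\ast y)\cdot x=y$ for all $x,y\in X$. A magma $(X,\cdot)$ is right involutory if $(x\cdot y)\cdot y=x$ for all $x,y\in X$. A magma $(X,\ast)$ is left involutory if $y\ast(y\ast x)=x$ for all $x,y\in X$. A map $R:X\times X\to X\times X$ is a YB-solution if $R^{12}R^{13}R^{23}=R^{23}R^{13}R^{12}$ as maps $X^3\to X^3$, where $R^{ij}$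 acts as $R$ on the $i$-th and $j$-th coordinates and as the identity on the remaining one. With $\tau_X(x,y)=(y,x)$ and $R^{21}=\tau_X R\,\tau_X$, $R$ is unitary if $R^{21}R=\mathrm{Id}_{X\times X}$ and involutive if $R^2=\mathrm{Id}_{X\times X}$. The map $R(x,y)=(x\cdot y,x\ast y)$ is (left-right) non-degenerate if for every $a\in X$ the maps $y\mapsto a\cdot y$ and $x\mapsto x\ast a$ are bijections of $X$. *)

theory Defs
  imports Main
begin

locale magma =
  fixes X :: "'a set" and mult :: "'a \<Rightarrow> 'a \<Rightarrow> 'a"
  assumes closed: "x \<in> X \<Longrightarrow> y \<in> X \<Longrightarrow> mult x y \<in> X"

locale right_plonka_magma = magma X dot
  for X :: "'a set" and dot :: "'a \<Rightarrow> 'a \<Rightarrow> 'a" (infixl "\<cdot>" 70) +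
  assumes right_comm: "\<lbrakk>x \<in> X; y \<in> X; z \<in> X\<rbrakk> \<Longrightarrow> (x \<cdot> y) \<cdot> z = (x \<cdot> z) \<cdot> y"
    and right_absorb: "\<lbrakk>x \<in> X; y \<in> X; z \<in> X\<rbrakk> \<Longrightarrow> x \<cdot> (y \<cdot> z) = x \<cdot> y"

locale left_plonka_magma = magma X ast
  for X :: "'a set" and ast :: "'a \<Rightarrow> 'a \<Rightarrow> 'a" (infixl "\<ast>" 70) +
  assumes left_comm: "\<lbrakk>x \<in> X; y \<in> X; z \<in> X\<rbrakk> \<Longrightarrow> x \<ast> (y \<ast> z) = y \<ast> (x \<ast> z)"
    and left_absorb: "\<lbrakk>x \<in> X; y \<in> X; z \<in> X\<rbrakk> \<Longrightarrow> (x \<ast> y) \<ast> z = y \<ast> z"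

locale plonka_bimagma =
  right: right_plonka_magma X dot + left: left_plonka_magma X ast
  for X :: "'a set"
    and dot :: "'a \<Rightarrow> 'a \<Rightarrow> 'a" (infixl "\<cdot>" 70)
    and ast :: "'a \<Rightarrow> 'a \<Rightarrow> 'a" (infixl "\<ast>" 70) +
  assumes ast_dot: "\<lbrakk>x \<in> X; y \<in> X; z \<in> X\<rbrakk> \<Longrightarrow> x \<ast> (y \<cdot> z) = (x \<ast> y) \<cdot> z"
    and dot_ast: "\<lbrakk>x \<in> X; y \<in> X; z \<in> X\<rbrakk> \<Longrightarrow> (x \<cdot> z) \<ast> y = x \<ast> y"
    and dot_absorb_ast: "\<lbrakk>x \<in> X; y \<in> X; z \<in> X\<rbrakk> \<Longrightarrow> x \<cdot> (y \<ast> z) = x \<cdot> z"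

locale unitary_plonka_bimagma = plonka_bimagma X dot ast
  for X :: "'a set"
    and dot :: "'a \<Rightarrow> 'a \<Rightarrow> 'a" (infixl "\<cdot>" 70)
    and ast :: "'a \<Rightarrow> 'a \<Rightarrow> 'a" (infixl "\<ast>" 70) +
  assumes unitary: "\<lbrakk>x \<in> X; y \<in> X\<rbrakk> \<Longrightarrow> (x \<ast> y) \<cdot> x = y"

locale right_involutory_magma = magma X dot
  for X :: "'a set" and dot :: "'a \<Rightarrow> 'a \<Rightarrow> 'a" (infixl "\<cdot>" 70) +
  assumes right_invol: "\<lbrakk>x \<in> X; y \<in> X\<rbrakk> \<Longrightarrow> (x \<cdot> y) \<cdot> y = x"

locale left_involutory_magma = magma X ast
  for X :: "'a set" and ast :: "'a \<Rightarrow> 'a \<Rightarrow> 'a" (infixl "\<ast>" 70) +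
  assumes left_invol: "\<lbrakk>x \<in> X; y \<in> X\<rbrakk> \<Longrightarrow> y \<ast> (y \<ast> x) = x"

text \<open>
  A map \<open>R : X \<times> X \<rightarrow> X \<times> X\<close> is represented by a function on the ambient type. Only its values on
  \<open>X \<times> X\<close> are meaningful, so identities between maps are required on the carrier only.
\<close>

definition R12 :: "('a \<times> 'a \<Rightarrow> 'a \<times> 'a) \<Rightarrow> 'a \<times> 'a \<times> 'a \<Rightarrow> 'a \<times> 'a \<times> 'a" where
  "R12 R = (\<lambda>(x, y, z). let (x', y') = R (x, y) in (x', y', z))"

definition R13 :: "('a \<times> 'a \<Rightarrow> 'a \<times> 'a) \<Rightarrow> 'a \<times> 'a \<times> 'a \<Rightarrow> 'a \<times> 'a \<times> 'a" where
  "R13 R = (\<lambda>(x, y, z). let (x', z') = R (x, z) in (x', y, z'))"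

definition R23 :: "('a \<times> 'a \<Rightarrow> 'a \<times> 'a) \<Rightarrow> 'a \<times> 'a \<times> 'a \<Rightarrow> 'a \<times> 'a \<times> 'a" where
  "R23 R = (\<lambda>(x, y, z). let (y', z') = R (y, z) in (x, y', z'))"

definition R21 :: "('a \<times> 'a \<Rightarrow> 'a \<times> 'a) \<Rightarrow> 'a \<times> 'a \<Rightarrow> 'a \<times> 'a" where
  "R21 R = prod.swap \<circ> R \<circ> prod.swap"

definition YB_solution :: "'a set \<Rightarrow> ('a \<times> 'a \<Rightarrow> 'a \<times> 'a) \<Rightarrow> bool" where
  "YB_solution X R \<longleftrightarrow>
     R ` (X \<times> X) \<subseteq> X \<times> X \<and>
     (\<forall>p \<in> X \<times> X \<times> X. (R12 R \<circ> R13 R \<circ> R23 R) p = (R23 R \<circ> R13 R \<circ> R12 R) p)"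

definition unitary_map :: "'a set \<Rightarrow> ('a \<times> 'a \<Rightarrow> 'a \<times> 'a) \<Rightarrow> bool" where
  "unitary_map X R \<longleftrightarrow> (\<forall>p \<in> X \<times> X. (R21 R \<circ> R) p = p)"

definition involutive_map :: "'a set \<Rightarrow> ('a \<times> 'a \<Rightarrow> 'a \<times> 'a) \<Rightarrow> bool" where
  "involutive_map X R \<longleftrightarrow> (\<forall>p \<in> X \<times> X. (R \<circ> R) p = p)"

definition nondegenerate_map :: "'a set \<Rightarrow> ('a \<times> 'a \<Rightarrow> 'a \<times> 'a) \<Rightarrow> bool" where
  "nondegenerate_map X R \<longleftrightarrow>
     (\<forall>a \<in> X. bij_betw (\<lambda>y. fst (R (a, y))) X X \<and> bij_betw (\<lambda>x. snd (R (x, a))) X X)"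

definition canonical_map :: "('a \<Rightarrow> 'a \<Rightarrow> 'a) \<Rightarrow> ('a \<Rightarrow> 'a \<Rightarrow> 'a) \<Rightarrow> 'a \<times> 'a \<Rightarrow> 'a \<times> 'a" where
  "canonical_map dot ast = (\<lambda>(x, y). (dot x y, ast x y))"

end

theory Submission
  imports Defs
begin

text \<open>The absorption laws let an inner product inside an argument shrink to one of its
  factors, so each composite of \<open>R\<close> has short coordinates. The Yang-Baxter equation
  then follows from the two commutation laws and \<open>ast_dot\<close>. Reducing
  \<open>R21 R\<close> and \<open>R R\<close> the same way leaves exactly the identities defining
  the unitary and the involutory cases. Non-degeneracy clashes with absorption: a left translation
  by \<open>\<cdot>\<close> that is injective has to be constant, and being also onto it leaves a
  single point.\<close>

context plonka_bimagma
begin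

lemma YB_solution_canonical_map: "YB_solution X (canonical_map dot ast)"
  unfolding YB_solution_def
proof (intro conjI ballI)
  show "canonical_map dot ast ` (X \<times> X) \<subseteq> X \<times> X"
    by (auto simp: canonical_map_def right.closed left.closed)
next
  let ?R = "canonical_map dot ast"
  fix p assume "p \<in> X \<times> X \<times> X"
  then obtain x y z where p: "p = (x, y, z)" and X: "x \<in> X" "y \<in> X" "z \<in> X"
    by auto
  \<comment> \<open>Facts 1 to 3 match the two sides coordinate by coordinate. In the second, the
    right side arises as \<open>(x \<ast> y) \<cdot> ((x \<cdot> y) \<ast> z)\<close>, which
    \<open>dot_absorb_ast\<close> shrinks to \<open>(x \<ast> y) \<cdot> z\<close>.\<close>
  have 1: "x \<cdot> (y \<ast> z) \<cdot> (y \<cdot> z) = x \<cdot> y \<cdot> z"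
    using X right.right_comm by (simp add: dot_absorb_ast right.right_absorb right.closed)
  have 2: "(x \<cdot> (y \<ast> z)) \<ast> (y \<cdot> z) = (x \<ast> y) \<cdot> z"
    using X by (simp add: dot_ast ast_dot right.closed left.closed)
  have 3: "x \<ast> (y \<ast> z) = (x \<ast> y) \<ast> ((x \<cdot> y) \<ast> z)"
    using X left.left_comm by (simp add: dot_ast left.left_absorb left.closed)
  show "(R12 ?R \<circ> R13 ?R \<circ> R23 ?R) p = (R23 ?R \<circ> R13 ?R \<circ> R12 ?R) p"
    using X 1 2 3
    by (simp add: p R12_def R13_def R23_def canonical_map_def dot_absorb_ast right.closed left.closed)
qed

text \<open>Both coordinates of \<open>R21 R\<close> carry the same identity with \<open>x\<close>
  and \<open>y\<close> exchanged; the first gets its form from \<open>(x \<ast> y) \<ast> (x \<cdot>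
  y) = y \<ast> (x \<cdot> y) = (y \<ast> x) \<cdot> y\<close>.\<close>

lemma unitary_map_canonical_map_iff:
  "unitary_map X (canonical_map dot ast) \<longleftrightarrow> (\<forall>x\<in>X. \<forall>y\<in>X. (x \<ast> y) \<cdot> x = y)"
proof -
  have "(R21 (canonical_map dot ast) \<circ> canonical_map dot ast) (x, y)
      = ((y \<ast> x) \<cdot> y, (x \<ast> y) \<cdot> x)" if "x \<in> X" "y \<in> X" for x y
    using that
    by (simp add: R21_def canonical_map_def left.left_absorb ast_dot right.right_absorb
        right.closed left.closed)
  then show ?thesis
    unfolding unitary_map_def by auto
qed

lemma involutive_map_canonical_map_iff:
  "involutive_map X (canonical_map dot ast) \<longleftrightarrow>
     (\<forall>x\<in>X. \<forall>y\<in>X. x \<cdot> y \<cdot> y = x \<and> x \<ast> (x \<ast> y) = y)"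
proof -
  have "(canonical_map dot ast \<circ> canonical_map dot ast) (x, y)
      = (x \<cdot> y \<cdot> y, x \<ast> (x \<ast> y))" if "x \<in> X" "y \<in> X" for x y
    using that by (simp add: canonical_map_def dot_absorb_ast dot_ast right.closed left.closed)
  then show ?thesis
    unfolding involutive_map_def by auto
qed

text \<open>Cancelling \<open>a\<close> in \<open>a \<cdot> (y \<cdot> z) = a \<cdot> y\<close> makes every \<open>y \<mapsto> a \<cdot> y\<close> constant.\<close>

lemma nondegenerate_map_canonical_mapD:
  assumes "nondegenerate_map X (canonical_map dot ast)" and a: "a \<in> X"
  shows "X = {a}"
proof -
  have bij: "bij_betw (\<lambda>y. a \<cdot> y) X X"
    using assms by (simp add: nondegenerate_map_def canonical_map_def)
  \<comment> \<open>Injectivity is applied to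
    \<open>a \<cdot> (a \<cdot> y) = a \<cdot> a\<close>.\<close>
  have const: "a \<cdot> y = a" if y: "y \<in> X" for y
    using bij right.right_absorb[OF a a y] right.closed[OF a y] a
    by (auto simp: bij_betw_def dest: inj_onD)
  have "X = (\<lambda>y. a \<cdot> y) ` X"
    using bij by (simp add: bij_betw_def)
  also have "\<dots> = {a}"
    using const a by auto
  finally show ?thesis .
qed

lemma nondegenerate_map_canonical_map_singleton:
  assumes "X = {s}"
  shows "nondegenerate_map X (canonical_map dot ast)"
  using assms right.closed[of s s] left.closed[of s s]
  by (simp add: nondegenerate_map_def canonical_map_def bij_betw_def)

end

theorem theoremA:
  fixes X :: "'a set" and dot ast :: "'a \<Rightarrow> 'a \<Rightarrow> 'a"
  assumes "plonka_bimagma X dot ast"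
  shows "YB_solution X (canonical_map dot ast) \<and>
    (unitary_map X (canonical_map dot ast) \<longleftrightarrow> unitary_plonka_bimagma X dot ast) \<and>
    (involutive_map X (canonical_map dot ast) \<longleftrightarrow>
       right_involutory_magma X dot \<and> left_involutory_magma X ast) \<and>
    (X \<noteq> {} \<longrightarrow>
       (nondegenerate_map X (canonical_map dot ast) \<longleftrightarrow> (\<exists>s. X = {s})))"
proof -
  interpret plonka_bimagma X dot ast by fact
  have "unitary_map X (canonical_map dot ast) \<longleftrightarrow> unitary_plonka_bimagma X dot ast"
    unfolding unitary_map_canonical_map_iff unitary_plonka_bimagma_def
      unitary_plonka_bimagma_axioms_def
    using assms by blast
  moreover have "involutive_map X (canonical_map dot ast) \<longleftrightarrow>
      right_involutory_magma X dot \<and> left_involutory_magma X ast"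
    unfolding involutive_map_canonical_map_iff right_involutory_magma_def
      left_involutory_magma_def right_involutory_magma_axioms_def left_involutory_magma_axioms_def
    using right.magma_axioms left.magma_axioms by blast
  \<comment> \<open>An empty carrier is vacuously non-degenerate; a nonempty one supplies the point
    \<open>a\<close>.\<close>
  moreover have "nondegenerate_map X (canonical_map dot ast) \<longleftrightarrow> (\<exists>s. X = {s})" if "X \<noteq> {}"
    using that nondegenerate_map_canonical_mapD nondegenerate_map_canonical_map_singleton
    by blast
  ultimately show ?thesis
    using YB_solution_canonical_map by blast
qed

end
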